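(* Let $\mathcal I,\mathcal J$ be ideals on $\omega$ and let $\mathcal F\subseteq\omega^\omega$. If $\mathfrak{fip}(\mathcal I,\mathcal J,\mathcal F)\ge|\mathcal F|$, then there exists an ultrafilter $\mathcal U$ on $\omega$ such that $\mathcal I\not\le_{\mathcal F}\mathcal U^*$ and $\mathcal J\subseteq\mathcal U^*$. In particular, if (under this assumption) $\mathcal F=\omega^\omega$ ($\mathcal F$ is the family of all finite-to-one functions, or $\mathcal F$ is the family of all one-to-one functions $\omega\to\omega$, respectively), then there exists an $\mathcal I$-ultrafilter (a weak $\mathcal I$-ultrafilter, or an $\mathcal I$-point, respectively) which is not a $\mathcal J$-point.
   Context: An ideal on $\omega$ is a family of subsets of $\omega$ closed under finite unions and subsets, containing all finite sets and not containing $\omega$; $\mathcal J^+=\mathcal P(\omega)\setminus\mathcal J$. Ultrafilters on $\omega$ contain all cofinite sets; $\mathcal U^*=\{\omega\setminus A:A\in\mathcal U\}$ is the dual ideal. For $\mathcal F\subseteq\omega^\omega$ and ideals $\mathcal I,\mathcal K$ on $\omega$, $\mathcal I\le_{\mathcal F}\mathcal K$ means that there is $f\in\mathcal F$ with $f^{-1}[B]\in\mathcal K$ for every $B\in\mathcal I$. A nonempty family $\mathcal A\subseteq\mathcal P(\omega)$ has $\mathcal J^+$-FIP if $\bigcap F\in\mathcal J^+$ for each finite $F\subseteq\mathcal A$. With $\mathfrak c=2^{\aleph_0}$ and $\mathfrak c^+$ its successor cardinal, $\mathfrak{fip}(\mathcal I,\mathcal J,\mathcal F)$ is the minimum of the set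 consisting of $\mathfrak c^+$ and all cardinals $|\mathcal A|$ such that $\mathcal A$ has $\mathcal J^+$-FIP (so $\mathcal A$ is a nonempty family of subsets of $\omega$) and it is not true that for every $f\in\mathcal F$ there is $B\in\mathcal I$ such that $\mathcal A\cup\{f^{-1}[B]\}$ has $\mathcal J^+$-FIP. An ultrafilter $\mathcal U$ on $\omega$ is an $\mathcal I$-ultrafilter (weak $\mathcal I$-ultrafilter, $\mathcal I$-point, respectively) if $\mathcal I\not\le_{\mathcal F}\mathcal U^*$ where $\mathcal F$ is the family of all (all finite-to-one, all one-to-one, respectively) functions $\omega\to\omega$; a $\mathcal J$-point is defined in the same way with $\mathcal J$ in place of $\mathcal I$. A function is finite-to-one if preimages of points are finite.
   Formalization: If F has exactly one element, the assumption is fip(I,J,F) > 1 instead of ≥ 1; as stated the claim fails for I = J = Fin, F = {id}, where the family {ω} gives fip = 1 = |F| but I ≤_F U* for every ultrafilter U. *)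

theory Defs
  imports Complex_Main
begin

unbundle cardinal_syntax

definition ideal_on_nat :: "nat set set \<Rightarrow> bool" where
  "ideal_on_nat I \<longleftrightarrow>
     (\<forall>A\<in>I. \<forall>B\<in>I. A \<union> B \<in> I) \<and> (\<forall>A\<in>I. \<forall>B. B \<subseteq> A \<longrightarrow> B \<in> I) \<and>
     (\<forall>A. finite A \<longrightarrow> A \<in> I) \<and> UNIV \<notin> I"

definition ultrafilter_on_nat :: "nat set set \<Rightarrow> bool" where
  "ultrafilter_on_nat U \<longleftrightarrow>
     {} \<notin> U \<and> (\<forall>A\<in>U. \<forall>B\<in>U. A \<inter> B \<in> U) \<and> (\<forall>A\<in>U. \<forall>B. A \<subseteq> B \<longrightarrow> B \<in> U) \<and>
     (\<forall>A. A \<in> U \<or> UNIV - A \<in> U) \<and> (\<forall>A. finite (UNIV - A) \<longrightarrow> A \<in> U)"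

definition dual_ideal :: "nat set set \<Rightarrow> nat set set" where
  "dual_ideal U = {UNIV - A | A. A \<in> U}"

definition ideal_le :: "(nat \<Rightarrow> nat) set \<Rightarrow> nat set set \<Rightarrow> nat set set \<Rightarrow> bool" where
  "ideal_le F I K \<longleftrightarrow> (\<exists>f\<in>F. \<forall>B\<in>I. f -` B \<in> K)"

definition has_positive_fip :: "nat set set \<Rightarrow> nat set set \<Rightarrow> bool" where
  "has_positive_fip J \<A> \<longleftrightarrow> \<A> \<noteq> {} \<and> (\<forall>E. finite E \<and> E \<subseteq> \<A> \<longrightarrow> \<Inter>E \<notin> J)"

definition fip_witness ::
  "nat set set \<Rightarrow> nat set set \<Rightarrow> (nat \<Rightarrow> nat) set \<Rightarrow> nat set set \<Rightarrow> bool" where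
  "fip_witness I J F \<A> \<longleftrightarrow>
     has_positive_fip J \<A> \<and> \<not> (\<forall>f\<in>F. \<exists>B\<in>I. has_positive_fip J (\<A> \<union> {f -` B}))"

text \<open>
  Cardinals are represented by cardinal orders, up to \<open>=o\<close>. The type \<open>nat set set\<close> is large
  enough to carry an order of type \<open>cardSuc |UNIV :: nat set set|\<close>, the successor of the
  continuum, so all cardinals in question have representatives in \<open>nat set set rel\<close>.
\<close>

definition fip_cardinals ::
  "nat set set \<Rightarrow> nat set set \<Rightarrow> (nat \<Rightarrow> nat) set \<Rightarrow> nat set set rel set" where
  "fip_cardinals I J F =
     {r. Card_order r \<and>
         (r =o cardSuc |UNIV :: nat set set| \<or> (\<exists>\<A>. fip_witness I J F \<A> \<and> r =o |\<A>| ))}"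

text \<open>
  The minimum exists, because \<open>\<le>o\<close> well-orders cardinal orders up to \<open>=o\<close>, and it is unique
  up to \<open>=o\<close>. Use it only under \<open>\<le>o\<close>, \<open><o\<close> and \<open>=o\<close>.

  Since witnesses are nonempty, the value is always at least one, and it can be one: for
  \<open>F = {id}\<close> and \<open>J = I\<close> the family \<open>{UNIV}\<close> is a witness, although every ultrafilter
  \<open>U\<close> with \<open>J \<subseteq> dual_ideal U\<close> satisfies \<open>ideal_le F I (dual_ideal U)\<close>. Hence
  \<open>|F| \<le>o fip I J F\<close> says nothing for a singleton \<open>F\<close>.
\<close>

definition fip :: "nat set set \<Rightarrow> nat set set \<Rightarrow> (nat \<Rightarrow> nat) set \<Rightarrow> nat set set rel" where
  "fip I J F = (SOME r. r \<in> fip_cardinals I J F \<and> (\<forall>s\<in>fip_cardinals I J F. r \<le>o s))"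

definition finite_to_one :: "(nat \<Rightarrow> nat) \<Rightarrow> bool" where
  "finite_to_one f \<longleftrightarrow> (\<forall>n. finite (f -` {n}))"

definition ideal_ultrafilter :: "nat set set \<Rightarrow> nat set set \<Rightarrow> bool" where
  "ideal_ultrafilter I U \<longleftrightarrow> ultrafilter_on_nat U \<and> \<not> ideal_le UNIV I (dual_ideal U)"

definition weak_ideal_ultrafilter :: "nat set set \<Rightarrow> nat set set \<Rightarrow> bool" where
  "weak_ideal_ultrafilter I U \<longleftrightarrow>
     ultrafilter_on_nat U \<and> \<not> ideal_le {f. finite_to_one f} I (dual_ideal U)"

definition ideal_point :: "nat set set \<Rightarrow> nat set set \<Rightarrow> bool" where
  "ideal_point I U \<longleftrightarrow> ultrafilter_on_nat U \<and> \<not> ideal_le {f. inj f} I (dual_ideal U)"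

end

(*
  Enumerate F along the cardinal order |F| and choose recursively B f in I such that the
  preimages of the sets B g, for g up to f, have the J-positive finite intersection property.
  Before stage f fewer than |F| preimages have been chosen, so their family is too small to be
  a witness for fip and B f exists.  An ultrafilter that extends all the preimages and avoids J
  is as required, and it is not a J-point because of the identity function.
*)
theory Submission
  imports Defs
begin

section \<open>Positive finite intersection property and ultrafilters\<close>

lemma has_positive_fip_mono:
  assumes "has_positive_fip J \<A>" and "\<B> \<subseteq> \<A>" and "\<B> \<noteq> {}"
  shows "has_positive_fip J \<B>"
  using assms unfolding has_positive_fip_def by (meson order_trans)

text \<open>A finite subfamily of the union lies in one member of the chain. This serves both Zorn's
  lemma and the limit stages of the recursion.\<close>

lemma has_positive_fip_Union_chain:
  assumes "\<C> \<noteq> {}" and "subset.chain UNIV \<C>"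
    and "\<And>\<A>. \<A> \<in> \<C> \<Longrightarrow> has_positive_fip J \<A>"
  shows "has_positive_fip J (\<Union>\<C>)"
  unfolding has_positive_fip_def
proof (intro conjI allI impI)
  show "\<Union>\<C> \<noteq> {}"
    using assms(1,3) unfolding has_positive_fip_def by auto
  fix E assume "finite E \<and> E \<subseteq> \<Union>\<C>"
  then obtain \<A> where "\<A> \<in> \<C>" "E \<subseteq> \<A>"
    using finite_subset_Union_chain[of E \<C>] assms(1,2) by blast
  then show "\<Inter>E \<notin> J"
    using assms(3) \<open>finite E \<and> E \<subseteq> \<Union>\<C>\<close> unfolding has_positive_fip_def by blast
qed

lemma ex_maximal_has_positive_fip:
  assumes "has_positive_fip J \<A>"
  obtains M where "\<A> \<subseteq> M" and "has_positive_fip J M"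
    and "\<And>\<B>. has_positive_fip J \<B> \<Longrightarrow> M \<subseteq> \<B> \<Longrightarrow> \<B> = M"
proof -
  let ?Z = "{\<B>. \<A> \<subseteq> \<B> \<and> has_positive_fip J \<B>}"
  have "\<exists>M\<in>?Z. \<forall>X\<in>?Z. M \<subseteq> X \<longrightarrow> X = M"
  proof (rule subset_Zorn_nonempty)
    show "?Z \<noteq> {}"
      using assms by blast
    fix \<C> assume \<C>: "\<C> \<noteq> {}" "subset.chain ?Z \<C>"
    then have "has_positive_fip J (\<Union>\<C>)"
      by (intro has_positive_fip_Union_chain) (auto simp: subset.chain_def)
    moreover have "\<A> \<subseteq> \<Union>\<C>"
      using \<C> unfolding subset_chain_def by blast
    ultimately show "\<Union>\<C> \<in> ?Z"
      by simp
  qed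
  then show thesis
    using that by auto
qed

text \<open>A maximal extension \<open>M\<close> of \<A> is already an ultrafilter: every set that
  can be added to it belongs to it. No member of \<open>J\<close> lies in \<open>M\<close>, so the
  complement of each does.\<close>

lemma ex_ultrafilter_extending:
  assumes J: "ideal_on_nat J" and \<A>: "has_positive_fip J \<A>"
  obtains U where "ultrafilter_on_nat U" and "\<A> \<subseteq> U" and "J \<subseteq> dual_ideal U"
proof -
  obtain M where M: "\<A> \<subseteq> M" "has_positive_fip J M"
    and max: "\<And>\<B>. has_positive_fip J \<B> \<Longrightarrow> M \<subseteq> \<B> \<Longrightarrow> \<B> = M"
    using ex_maximal_has_positive_fip[OF \<A>] by metis
  have pos: "\<Inter>E \<notin> J" if "finite E" "E \<subseteq> M" for E
    using M(2) that unfolding has_positive_fip_def by blast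
  have down: "B \<in> J" if "A \<in> J" "B \<subseteq> A" for A B
    using J that unfolding ideal_on_nat_def by blast
  have un: "A \<union> B \<in> J" if "A \<in> J" "B \<in> J" for A B
    using J that unfolding ideal_on_nat_def by blast
  have fin: "A \<in> J" if "finite A" for A
    using J that unfolding ideal_on_nat_def by blast
  \<comment> \<open>Maximality turned into a membership test: \<open>X\<close> belongs to
    \<open>M\<close> once it meets every finite intersection from \<open>M\<close> in a
    \<open>J\<close>-positive set. The closure properties below are read off from it.\<close>
  have memI: "X \<in> M" if X: "\<And>E. finite E \<Longrightarrow> E \<subseteq> M \<Longrightarrow> \<Inter>E \<inter> X \<notin> J" for X
  proof -
    have "\<Inter>E \<notin> J" if E: "finite E" "E \<subseteq> insert X M" for E
    proof -
      have "\<Inter>(E - {X}) \<inter> X \<notin> J"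
        using E by (intro X) auto
      moreover have "\<Inter>(E - {X}) \<inter> X \<subseteq> \<Inter>E"
        by blast
      ultimately show ?thesis
        using down by blast
    qed
    then have "has_positive_fip J (insert X M)"
      unfolding has_positive_fip_def by simp
    then show ?thesis
      using max by blast
  qed
  have up: "B \<in> M" if "A \<in> M" "A \<subseteq> B" for A B
  proof (rule memI)
    fix E assume "finite E" "E \<subseteq> M"
    with that have "\<Inter>(insert A E) \<notin> J"
      by (intro pos) auto
    moreover have "\<Inter>(insert A E) \<subseteq> \<Inter>E \<inter> B"
      using that by auto
    ultimately show "\<Inter>E \<inter> B \<notin> J"
      using down by blast
  qed
  have inter: "A \<inter> B \<in> M" if "A \<in> M" "B \<in> M" for A B
  proof (rule memI)
    fix E assume "finite E" "E \<subseteq> M"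
    with that have "\<Inter>(insert A (insert B E)) \<notin> J"
      by (intro pos) auto
    then show "\<Inter>E \<inter> (A \<inter> B) \<notin> J"
      by (simp add: Int_ac)
  qed
  have ultra: "A \<in> M \<or> UNIV - A \<in> M" for A
  proof (rule ccontr)
    assume "\<not> ?thesis"
    \<comment> \<open>The test fails for \<open>A\<close> and for its complement. The finite
      families \<open>D\<close> and \<open>E\<close> that show this have a common intersection
      covered by two sets in \<open>J\<close>, against positivity.\<close>
    then obtain D E where D: "finite D" "D \<subseteq> M" "\<Inter>D \<inter> A \<in> J"
      and E: "finite E" "E \<subseteq> M" "\<Inter>E \<inter> (UNIV - A) \<in> J"
      using memI by meson
    have "\<Inter>(D \<union> E) \<subseteq> (\<Inter>D \<inter> A) \<union> (\<Inter>E \<inter> (UNIV - A))"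
      by blast
    then have "\<Inter>(D \<union> E) \<in> J"
      using D(3) E(3) un down by blast
    moreover have "\<Inter>(D \<union> E) \<notin> J"
      using D E by (intro pos) auto
    ultimately show False
      by blast
  qed
  have not_ideal: "A \<notin> J" if "A \<in> M" for A
    using pos[of "{A}"] that by simp
  have compl: "UNIV - A \<in> M" if "A \<in> J" for A
    using ultra not_ideal that by blast
  show thesis
  proof (rule that)
    have empty: "{} \<notin> M"
      using not_ideal fin by blast
    have cofinite: "A \<in> M" if "finite (UNIV - A)" for A
      using compl[OF fin[OF that]] by (simp add: Diff_Diff_Int)
    show "ultrafilter_on_nat M"
      unfolding ultrafilter_on_nat_def
      by (intro conjI ballI allI impI empty inter ultra; (assumption | (rule up, assumption+) | (rule cofinite, assumption)))
    show "\<A> \<subseteq> M"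
      by (fact M(1))
    show "J \<subseteq> dual_ideal M"
    proof
      fix A assume "A \<in> J"
      then have "UNIV - A \<in> M" "A = UNIV - (UNIV - A)"
        using compl by auto
      then show "A \<in> dual_ideal M"
        unfolding dual_ideal_def by blast
    qed
  qed
qed

section \<open>Families of cardinality below \<open>fip\<close>\<close>

lemma fip_minimal:
  assumes "s \<in> fip_cardinals I J F"
  shows "fip I J F \<le>o s"
proof -
  \<comment> \<open>A nonempty set of cardinal orders has a least element, so the choice in the
    definition of \<open>fip\<close> picks one.\<close>
  have "\<exists>r\<in>fip_cardinals I J F. \<forall>s\<in>fip_cardinals I J F. r \<le>o s"
    using assms by (intro exists_minim_Card_order) (auto simp: fip_cardinals_def)
  then have "fip I J F \<in> fip_cardinals I J F \<and> (\<forall>s\<in>fip_cardinals I J F. fip I J F \<le>o s)"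
    unfolding fip_def Bex_def by (rule someI_ex)
  then show ?thesis
    using assms by blast
qed

text \<open>The order \<open>|\<A>|\<close> lives on \<open>nat set\<close>, one level below the
  type used in \<open>fip_cardinals\<close>; replacing each set by its singleton moves it
  up.\<close>

lemma fip_le_card_of_witness:
  assumes "fip_witness I J F \<A>"
  shows "fip I J F \<le>o |\<A>|"
proof -
  have "bij_betw (\<lambda>A. {A}) \<A> ((\<lambda>A. {A}) ` \<A>)"
    by (simp add: bij_betw_def)
  then have eq: "|(\<lambda>A. {A}) ` \<A>| =o |\<A>|"
    by (intro ordIso_symmetric[OF card_of_ordIsoI])
  then have "|(\<lambda>A. {A}) ` \<A>| \<in> fip_cardinals I J F"
    unfolding fip_cardinals_def mem_Collect_eq
    by (intro conjI disjI2 exI[of _ \<A>] card_of_Card_order assms)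
  from ordLeq_ordIso_trans[OF fip_minimal[OF this] eq] show ?thesis .
qed

text \<open>Every witness has cardinality at least \<open>fip I J F\<close>, so \<A> is not one, and
  negating the definition of a witness yields \<open>B\<close>.\<close>

lemma extend_below_fip:
  assumes "has_positive_fip J \<A>" and "|\<A>| <o fip I J F" and "f \<in> F"
  obtains B where "B \<in> I" and "has_positive_fip J (\<A> \<union> {f -` B})"
proof -
  have "\<not> fip_witness I J F \<A>"
    using fip_le_card_of_witness[of I J F \<A>] not_ordLess_ordLeq[OF assms(2)] by blast
  then show thesis
    using assms(1,3) that unfolding fip_witness_def by blast
qed

lemma has_positive_fip_UNIV:
  assumes "ideal_on_nat J"
  shows "has_positive_fip J {UNIV}"
proof -
  have "\<Inter>E \<notin> J" if "E \<subseteq> {UNIV}" for E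
  proof -
    have "\<Inter>E = UNIV"
      using that by blast
    moreover have "UNIV \<notin> J"
      using assms by (simp add: ideal_on_nat_def)
    ultimately show ?thesis
      by metis
  qed
  then show ?thesis
    unfolding has_positive_fip_def by blast
qed

text \<open>The recursion starts from \<open>{UNIV}\<close>, so one must lie strictly below
  \<open>fip\<close>. If \<open>F\<close> has two elements, one is less than \<open>|F|\<close>; for
  a singleton the strict hypothesis applies.\<close>

lemma singleton_ordLess_fip:
  assumes "|F| \<le>o fip I J F" and "is_singleton F \<longrightarrow> |F| <o fip I J F" and "F \<noteq> {}"
  shows "|{a}| <o fip I J F"
proof (cases "is_singleton F")
  case True
  then have "|F| <o fip I J F"
    using assms(2) by simp
  from ordLeq_ordLess_trans[OF card_of_singl_ordLeq[OF assms(3)] this] show ?thesis .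
next
  case False
  have "\<not> |F| \<le>o |{a}|"
  proof
    assume "|F| \<le>o |{a}|"
    then obtain g where g: "inj_on g F" "g ` F \<subseteq> {a}"
      using card_of_ordLeq[of F "{a}"] by auto
    have "x = y" if "x \<in> F" "y \<in> F" for x y
    proof (rule inj_onD[OF g(1) _ that])
      show "g x = g y"
        using g(2) that by auto
    qed
    then show False
      using False is_singletonI'[OF assms(3)] by blast
  qed
  then have "|{a}| <o |F|"
    using not_ordLeq_iff_ordLess[OF card_of_Well_order card_of_Well_order] by blast
  from ordLess_ordLeq_trans[OF this assms(1)] show ?thesis .
qed

section \<open>Transfinite recursion along \<open>|F|\<close>\<close>

lemma ex_preimages_has_positive_fip:
  assumes J: "ideal_on_nat J" and le: "|F| \<le>o fip I J F"
    and single: "is_singleton F \<longrightarrow> |F| <o fip I J F" and "F \<noteq> {}"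
  shows "\<exists>B. (\<forall>f\<in>F. B f \<in> I) \<and> has_positive_fip J ((\<lambda>f. f -` B f) ` F)"
proof -
  let ?r = "|F|"
  let ?S = "underS ?r"
  have field: "Field ?r = F"
    by (rule Field_card_of)
  have lin: "Linear_order ?r" and wf: "wf (?r - Id)"
    using card_of_Well_order[of F] by (auto simp: well_order_on_def)
  have refl: "(f, f) \<in> ?r" if "f \<in> F" for f
    using lin that field unfolding order_on_defs refl_on_def by auto
  have trans: "trans ?r"
    using lin unfolding order_on_defs by auto
  have under_insert: "under ?r f = insert f (?S f)" if "f \<in> F" for f
    using refl[OF that] unfolding under_def underS_def by auto
  \<comment> \<open>Initial segments are nested, so the families of preimages indexed by them form a
    chain.\<close>
  have under_total: "under ?r f \<subseteq> under ?r g \<or> under ?r g \<subseteq> under ?r f"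
    if "f \<in> F" "g \<in> F" for f g
  proof -
    have "(f, g) \<in> ?r \<or> (g, f) \<in> ?r"
      using lin that field refl unfolding order_on_defs total_on_def by metis
    then show ?thesis
      using trans under_incr by metis
  qed
  \<comment> \<open>\<open>X\<close> is an admissible value at \<open>f\<close>, given the values of
    \<open>B\<close> strictly below \<open>f\<close>. The guard makes the condition vacuous outside
    \<open>F\<close>, as the recursion runs over the whole type.\<close>
  let ?P = "\<lambda>B f X. f \<in> F \<longrightarrow>
    X \<in> I \<and> has_positive_fip J ((\<lambda>g. g -` B g) ` ?S f \<union> {f -` X})"
  have image_under: "(\<lambda>g. g -` B g) ` under ?r f = (\<lambda>g. g -` B g) ` ?S f \<union> {f -` B f}"
    if "f \<in> F" for B f
    using under_insert[OF that] by auto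
  \<comment> \<open>Used with \<open>S\<close> the strict predecessors of a stage, and at the end
    with \<open>S = F\<close>.\<close>
  have union: "has_positive_fip J (\<Union>f\<in>S. (\<lambda>g. g -` B g) ` under ?r f)"
    if S: "S \<noteq> {}" "S \<subseteq> F" "\<And>f. f \<in> S \<Longrightarrow> ?P B f (B f)" for S B
  proof (rule has_positive_fip_Union_chain)
    show "(\<lambda>f. (\<lambda>g. g -` B g) ` under ?r f) ` S \<noteq> {}"
      using S(1) by simp
    show "subset.chain UNIV ((\<lambda>f. (\<lambda>g. g -` B g) ` under ?r f) ` S)"
      unfolding subset_chain_def
    proof (intro conjI ballI)
      fix X Y
      assume "X \<in> (\<lambda>f. (\<lambda>g. g -` B g) ` under ?r f) ` S"
        and "Y \<in> (\<lambda>f. (\<lambda>g. g -` B g) ` under ?r f) ` S"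
      then obtain f g where fg: "f \<in> F" "g \<in> F"
        "X = (\<lambda>g. g -` B g) ` under ?r f" "Y = (\<lambda>g. g -` B g) ` under ?r g"
        using S(2) by blast
      show "X \<subseteq> Y \<or> Y \<subseteq> X"
        using under_total[OF fg(1,2)] unfolding fg(3,4) by (meson image_mono)
    qed simp
    fix X assume "X \<in> (\<lambda>f. (\<lambda>g. g -` B g) ` under ?r f) ` S"
    then obtain f where "f \<in> S" "X = (\<lambda>g. g -` B g) ` under ?r f"
      by blast
    then show "has_positive_fip J X"
      using S image_under by auto
  qed
  have step: "\<exists>X. ?P B f X" if IH: "\<And>g. (g, f) \<in> ?r - Id \<Longrightarrow> ?P B g (B g)" for f B
  proof (cases "f \<in> F")
    case f: True
    have S: "?S f \<subseteq> F"
      using field unfolding underS_def Field_def by blast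
    show ?thesis
    proof (cases "?S f = {}")
      case True
      \<comment> \<open>At the least \<open>f\<close> there are no preimages yet, and the empty
        family is excluded by definition. \<open>{UNIV}\<close> stands in for it and is then
        dropped.\<close>
      obtain X where "X \<in> I" "has_positive_fip J ({UNIV} \<union> {f -` X})"
        using extend_below_fip[OF has_positive_fip_UNIV[OF J]
            singleton_ordLess_fip[OF le single \<open>F \<noteq> {}\<close>] f] by blast
      with True show ?thesis
        using has_positive_fip_mono[of J "{UNIV} \<union> {f -` X}" "{f -` X}"] by auto
    next
      case False
      let ?A = "(\<lambda>g. g -` B g) ` ?S f"
      \<comment> \<open>The family before \<open>f\<close> is the union of the families up to
        \<open>h\<close>, over all \<open>h\<close> below \<open>f\<close>; this treats successor
        and limit stages alike.\<close>
      have "has_positive_fip J (\<Union>h\<in>?S f. (\<lambda>g. g -` B g) ` under ?r h)"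
        using False S IH by (intro union) (auto simp: underS_def)
      moreover have "?A \<subseteq> (\<Union>h\<in>?S f. (\<lambda>g. g -` B g) ` under ?r h)"
        using S under_insert by blast
      ultimately have "has_positive_fip J ?A"
        by (rule has_positive_fip_mono) (use False in simp)
      moreover have "|?A| <o fip I J F"
      proof -
        \<comment> \<open>Here it matters that \<open>?r\<close> is a cardinal order: its proper
          initial segments are strictly smaller than \<open>F\<close>.\<close>
        have "|?S f| <o |F|"
          using f field by (intro card_of_underS card_of_Card_order) simp
        from ordLess_ordLeq_trans[OF ordLeq_ordLess_trans[OF card_of_image this] le]
        show ?thesis .
      qed
      ultimately obtain X where "X \<in> I" "has_positive_fip J (?A \<union> {f -` X})"
        using extend_below_fip[OF _ _ f] by metis
      then show ?thesis
        by (intro exI[of _ X]) simp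
    qed
  qed simp
  have "\<exists>B. \<forall>f. ?P B f (B f)"
  \<comment> \<open>Besides \<open>step\<close>, the recursion requires that \<open>?P\<close> at
    \<open>f\<close> depend only on earlier values of \<open>B\<close>.\<close>
  proof (rule dependent_wf_choice[OF wf])
    fix B C :: "(nat \<Rightarrow> nat) \<Rightarrow> nat set" and f X
    assume "\<And>g. (g, f) \<in> ?r - Id \<Longrightarrow> B g = C g"
    then have "(\<lambda>g. g -` B g) ` ?S f = (\<lambda>g. g -` C g) ` ?S f"
      by (intro image_cong) (auto simp: underS_def)
    then show "?P B f X = ?P C f X"
      by simp
  qed (rule step)
  then obtain B where B: "\<And>f. ?P B f (B f)"
    by blast
  have "has_positive_fip J (\<Union>f\<in>F. (\<lambda>g. g -` B g) ` under ?r f)"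
    using B \<open>F \<noteq> {}\<close> by (intro union) auto
  moreover have "(\<lambda>f. f -` B f) ` F \<subseteq> (\<Union>f\<in>F. (\<lambda>g. g -` B g) ` under ?r f)"
    using under_insert by blast
  ultimately have "has_positive_fip J ((\<lambda>f. f -` B f) ` F)"
    by (rule has_positive_fip_mono) (use \<open>F \<noteq> {}\<close> in simp)
  with B show ?thesis
    by (intro exI[of _ B]) simp
qed

section \<open>From the preimages to the ultrafilter\<close>

lemma not_ideal_leI:
  assumes "ultrafilter_on_nat U" and "\<And>f. f \<in> F \<Longrightarrow> \<exists>B\<in>I. f -` B \<in> U"
  shows "\<not> ideal_le F I (dual_ideal U)"
proof
  assume "ideal_le F I (dual_ideal U)"
  then obtain f where "f \<in> F" and f: "\<And>B. B \<in> I \<Longrightarrow> f -` B \<in> dual_ideal U"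
    unfolding ideal_le_def by blast
  then obtain B where "B \<in> I" "f -` B \<in> U"
    using assms(2) by blast
  have "f -` B \<in> dual_ideal U"
    using f \<open>B \<in> I\<close> .
  then obtain A where A: "A \<in> U" "f -` B = UNIV - A"
    unfolding dual_ideal_def by blast
  then have "A \<inter> (UNIV - A) \<in> U"
    using \<open>f -` B \<in> U\<close> assms(1) unfolding ultrafilter_on_nat_def by metis
  then show False
    using assms(1) unfolding ultrafilter_on_nat_def by simp
qed

text \<open>The identity is one-to-one and pulls each member of \<open>J\<close> back to
  itself.\<close>

lemma not_ideal_point_if_subset_dual_ideal:
  assumes "J \<subseteq> dual_ideal U"
  shows "\<not> ideal_point J U"
proof -
  have "ideal_le {f. inj f} J (dual_ideal U)"
    unfolding ideal_le_def using assms by (intro bexI[of _ id]) auto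
  then show ?thesis
    by (simp add: ideal_point_def)
qed

theorem theorem3p2:
  fixes I J :: "nat set set" and F :: "(nat \<Rightarrow> nat) set"
  assumes "ideal_on_nat I" and "ideal_on_nat J"
    and "|F| \<le>o fip I J F"
    and "is_singleton F \<longrightarrow> |F| <o fip I J F"
  shows "(\<exists>U. ultrafilter_on_nat U \<and> \<not> ideal_le F I (dual_ideal U) \<and> J \<subseteq> dual_ideal U)
    \<and> (F = UNIV \<longrightarrow> (\<exists>U. ideal_ultrafilter I U \<and> \<not> ideal_point J U))
    \<and> (F = {f. finite_to_one f} \<longrightarrow> (\<exists>U. weak_ideal_ultrafilter I U \<and> \<not> ideal_point J U))
    \<and> (F = {f. inj f} \<longrightarrow> (\<exists>U. ideal_point I U \<and> \<not> ideal_point J U))"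
proof -
  \<comment> \<open>The family \<A> is kept separate from the preimages because for empty
    \<open>F\<close> there are none; \<open>{UNIV}\<close> then takes their place.\<close>
  have "\<exists>B \<A>. has_positive_fip J \<A> \<and> (\<forall>f\<in>F. B f \<in> I \<and> f -` B f \<in> \<A>)"
  proof (cases "F = {}")
    case True
    then show ?thesis
      using has_positive_fip_UNIV[OF assms(2)] by blast
  next
    case False
    from ex_preimages_has_positive_fip[OF assms(2-4) this]
    obtain B where "\<forall>f\<in>F. B f \<in> I" "has_positive_fip J ((\<lambda>f. f -` B f) ` F)"
      by (elim exE conjE)
    then show ?thesis
      by (intro exI[of _ B] exI[of _ "(\<lambda>f. f -` B f) ` F"]) simp
  qed
  then obtain B \<A> where \<A>: "has_positive_fip J \<A>"
    and B: "\<And>f. f \<in> F \<Longrightarrow> B f \<in> I \<and> f -` B f \<in> \<A>"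
    by blast
  obtain U where U: "ultrafilter_on_nat U" "\<A> \<subseteq> U" "J \<subseteq> dual_ideal U"
    using ex_ultrafilter_extending[OF assms(2) \<A>] by blast
  have "\<not> ideal_le F I (dual_ideal U)"
    using U(1,2) B by (intro not_ideal_leI) auto
  then show ?thesis
    using U(1,3) not_ideal_point_if_subset_dual_ideal[OF U(3)]
    by (intro conjI impI exI[of _ U])
      (simp_all add: ideal_ultrafilter_def weak_ideal_ultrafilter_def ideal_point_def[of I])
qed

end
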